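(* For all closed terms $p,q$ over $\Sigma_{\mathrm{BCCSP}_D^c}$, if $p$ and $q$ are strongly bisimilar with respect to $\mathrm{BCCSP}_D^c$, then $p=q$ is derivable from $E_{\mathrm{BCCSP}_D^c}$.
   Context: The data signature $\Sigma_D$ is a finite set of constants, and $L$ is a set of action labels. Closed terms over $\Sigma_{\mathrm{BCCSP}_D^c}$ are generated by $t ::= \mathbf{0} \mid l.t\ (l\in L) \mid \mathit{check}(d,t) \mid \mathit{update}(d,t) \mid t+t$ with $d\in\Sigma_D$. The transition system has labels $(d,l,d')$ with $d,d'\in\Sigma_D$, $l\in L$, and is given by the rules (for all data values $x_D,x'_D,y_D$): $l.x_P\xrightarrow{(x_D,l,x_D)}x_P$; if $x_P\xrightarrow{(x_D,l,x'_D)}x'_P$ then $\mathit{check}(x_D,x_P)\xrightarrow{(x_D,l,x'_D)}x'_P$; if $x_P\xrightarrow{(x_D,l,x'_D)}x'_P$ then $\mathit{update}(y_D,x_P)\xrightarrow{(x_D,l,y_D)}x'_P$; if $x_P\xrightarrow{(x_D,l,x'_D)}x'_P$ then $x_P+y_P\xrightarrow{(x_D,l,x'_D)}x'_P$ and $y_P+x_P\xrightarrow{(x_D,l,x'_D)}x'_P$. Strong bisimilarity: a symmetric relation $R$ on closed terms such that $(p,q)\in R$ and $p\xrightarrow{(d,l,d')}p'$ imply $q\xrightarrow{(d,l,d')}q'$ for some $q'$ with $(p',q')\in R$; $p,q$ are strongly bisimilar if related by such an $R$. $E_{\mathrm{BCCSP}_D^c}$ consists of: $x_P+y_P=y_P+x_P$;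 $x_P+(y_P+z_P)=(x_P+y_P)+z_P$; $x_P+x_P=x_P$; $x_P+\mathbf{0}=x_P$; $\mathit{check}(x_D,x_P+y_P)=\mathit{check}(x_D,x_P)+\mathit{check}(x_D,y_P)$; $\mathit{update}(x_D,x_P+y_P)=\mathit{update}(x_D,x_P)+\mathit{update}(x_D,y_P)$; $\mathit{check}(x_D,\mathit{update}(y_D,x_P))=\mathit{update}(y_D,\mathit{check}(x_D,x_P))$; $\mathit{update}(x_D,\mathit{update}(y_D,x_P))=\mathit{update}(x_D,x_P)$; $\mathit{check}(d,\mathit{check}(d,x_P))=\mathit{check}(d,x_P)$ for all $d\in\Sigma_D$; $\mathit{check}(d,\mathit{check}(d',x_P))=\mathbf{0}$ for all $d\neq d'$ in $\Sigma_D$; $l.x_P=\sum_{d\in\Sigma_D}\mathit{update}(d,\mathit{check}(d,l.x_P))$ for all $l\in L$. Derivability means membership in the smallest congruence containing all substitution instances of these equations.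
   Formalization: The data signature is assumed not to have exactly one element: if it is {d}, then check(d,0) and 0 are strongly bisimilar but check(d,0) = 0 is not derivable from the equations, so the claim fails as stated. *)

theory Defs
  imports Main
begin

text \<open>
  The data signature \<open>D\<close> and the label set \<open>L\<close> are carrier sets rather than types, so that they
  may be arbitrary sets, including empty ones.  The closed terms are the elements of
  \<open>closed_terms D L\<close>.
\<close>

datatype ('d, 'l) trm =
    Zero
  | Prefix 'l "('d, 'l) trm"
  | Check 'd "('d, 'l) trm"
  | Update 'd "('d, 'l) trm"
  | Plus "('d, 'l) trm" "('d, 'l) trm"

inductive_set closed_terms :: "'d set \<Rightarrow> 'l set \<Rightarrow> ('d, 'l) trm set"
  for D :: "'d set" and L :: "'l set" where
  zero: "Zero \<in> closed_terms D L"
| prefix: "l \<in> L \<Longrightarrow> t \<in> closed_terms D L \<Longrightarrow> Prefix l t \<in> closed_terms D L"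
| check: "d \<in> D \<Longrightarrow> t \<in> closed_terms D L \<Longrightarrow> Check d t \<in> closed_terms D L"
| update: "d \<in> D \<Longrightarrow> t \<in> closed_terms D L \<Longrightarrow> Update d t \<in> closed_terms D L"
| plus: "t \<in> closed_terms D L \<Longrightarrow> u \<in> closed_terms D L \<Longrightarrow> Plus t u \<in> closed_terms D L"

text \<open>
  On \<open>closed_terms D L\<close> the labels of the transitions lie in \<open>D \<times> L \<times> D\<close> and the targets are
  again closed terms, so no further side conditions are needed.
\<close>

inductive step :: "'d set \<Rightarrow> ('d, 'l) trm \<Rightarrow> 'd \<times> 'l \<times> 'd \<Rightarrow> ('d, 'l) trm \<Rightarrow> bool"
  for D :: "'d set" where
  prefix: "d \<in> D \<Longrightarrow> step D (Prefix l x) (d, l, d) x"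
| check: "step D x (d, l, d') x' \<Longrightarrow> step D (Check d x) (d, l, d') x'"
| update: "step D x (d, l, d') x' \<Longrightarrow> e \<in> D \<Longrightarrow> step D (Update e x) (d, l, e) x'"
| plus_left: "step D x (d, l, d') x' \<Longrightarrow> step D (Plus x y) (d, l, d') x'"
| plus_right: "step D x (d, l, d') x' \<Longrightarrow> step D (Plus y x) (d, l, d') x'"

definition bisimulation ::
  "'d set \<Rightarrow> 'l set \<Rightarrow> (('d, 'l) trm \<times> ('d, 'l) trm) set \<Rightarrow> bool" where
  "bisimulation D L R \<longleftrightarrow>
     R \<subseteq> closed_terms D L \<times> closed_terms D L \<and> sym R \<and>
     (\<forall>p q d l d' p'. (p, q) \<in> R \<longrightarrow> step D p (d, l, d') p' \<longrightarrow>
        (\<exists>q'. step D q (d, l, d') q' \<and> (p', q') \<in> R))"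

definition strongly_bisimilar ::
  "'d set \<Rightarrow> 'l set \<Rightarrow> ('d, 'l) trm \<Rightarrow> ('d, 'l) trm \<Rightarrow> bool" where
  "strongly_bisimilar D L p q \<longleftrightarrow> (\<exists>R. bisimulation D L R \<and> (p, q) \<in> R)"

definition sum_terms :: "('d, 'l) trm list \<Rightarrow> ('d, 'l) trm" where
  "sum_terms ts = foldr Plus ts Zero"

text \<open>
  Closed substitution instances of the equations.  A sum over \<open>D\<close> is a term only up to
  associativity, commutativity and the unit law (all of them axioms), so the last equation is
  imposed for every enumeration \<open>ds\<close> of \<open>D\<close>; the empty sum is \<open>Zero\<close>.
\<close>

inductive axiom_instance ::
  "'d set \<Rightarrow> 'l set \<Rightarrow> ('d, 'l) trm \<Rightarrow> ('d, 'l) trm \<Rightarrow> bool"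
  for D :: "'d set" and L :: "'l set" where
  plus_comm: "\<lbrakk>x \<in> closed_terms D L; y \<in> closed_terms D L\<rbrakk> \<Longrightarrow>
    axiom_instance D L (Plus x y) (Plus y x)"
| plus_assoc: "\<lbrakk>x \<in> closed_terms D L; y \<in> closed_terms D L; z \<in> closed_terms D L\<rbrakk> \<Longrightarrow>
    axiom_instance D L (Plus x (Plus y z)) (Plus (Plus x y) z)"
| plus_idem: "x \<in> closed_terms D L \<Longrightarrow> axiom_instance D L (Plus x x) x"
| plus_zero: "x \<in> closed_terms D L \<Longrightarrow> axiom_instance D L (Plus x Zero) x"
| check_plus: "\<lbrakk>d \<in> D; x \<in> closed_terms D L; y \<in> closed_terms D L\<rbrakk> \<Longrightarrow>
    axiom_instance D L (Check d (Plus x y)) (Plus (Check d x) (Check d y))"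
| update_plus: "\<lbrakk>d \<in> D; x \<in> closed_terms D L; y \<in> closed_terms D L\<rbrakk> \<Longrightarrow>
    axiom_instance D L (Update d (Plus x y)) (Plus (Update d x) (Update d y))"
| check_update: "\<lbrakk>d \<in> D; e \<in> D; x \<in> closed_terms D L\<rbrakk> \<Longrightarrow>
    axiom_instance D L (Check d (Update e x)) (Update e (Check d x))"
| update_update: "\<lbrakk>d \<in> D; e \<in> D; x \<in> closed_terms D L\<rbrakk> \<Longrightarrow>
    axiom_instance D L (Update d (Update e x)) (Update d x)"
| check_same: "\<lbrakk>d \<in> D; x \<in> closed_terms D L\<rbrakk> \<Longrightarrow>
    axiom_instance D L (Check d (Check d x)) (Check d x)"
| check_diff: "\<lbrakk>d \<in> D; d' \<in> D; d \<noteq> d'; x \<in> closed_terms D L\<rbrakk> \<Longrightarrow>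
    axiom_instance D L (Check d (Check d' x)) Zero"
| prefix_expand: "\<lbrakk>l \<in> L; x \<in> closed_terms D L; distinct ds; set ds = D\<rbrakk> \<Longrightarrow>
    axiom_instance D L (Prefix l x)
      (sum_terms (map (\<lambda>d. Update d (Check d (Prefix l x))) ds))"

inductive derivable :: "'d set \<Rightarrow> 'l set \<Rightarrow> ('d, 'l) trm \<Rightarrow> ('d, 'l) trm \<Rightarrow> bool"
  for D :: "'d set" and L :: "'l set" where
  ax: "axiom_instance D L x y \<Longrightarrow> derivable D L x y"
| refl: "x \<in> closed_terms D L \<Longrightarrow> derivable D L x x"
| sym: "derivable D L x y \<Longrightarrow> derivable D L y x"
| trans: "derivable D L x y \<Longrightarrow> derivable D L y z \<Longrightarrow> derivable D L x z"
| cong_prefix: "l \<in> L \<Longrightarrow> derivable D L x y \<Longrightarrow> derivable D L (Prefix l x) (Prefix l y)"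
| cong_check: "d \<in> D \<Longrightarrow> derivable D L x y \<Longrightarrow> derivable D L (Check d x) (Check d y)"
| cong_update: "d \<in> D \<Longrightarrow> derivable D L x y \<Longrightarrow> derivable D L (Update d x) (Update d y)"
| cong_plus: "derivable D L x y \<Longrightarrow> derivable D L x' y' \<Longrightarrow>
    derivable D L (Plus x x') (Plus y y')"

text \<open>
  If \<open>D = {d}\<close>, then \<open>Check d Zero\<close> and \<open>Zero\<close> are bisimilar but not provably equal:
  interpret \<open>Zero\<close> as \<open>False\<close>, \<open>Plus\<close> as disjunction, \<open>Update d\<close> as the identity, and
  \<open>Check d\<close> and all \<open>Prefix l\<close> as constantly \<open>True\<close>; this validates every equation.
  Ground completeness therefore requires that \<open>D\<close> is not a singleton.
\<close>

end

(* Provable inequality u \<le> v, meaning v + u = v, makes closed terms a join semilattice with join +.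
   Each transition (d, l, d') from t to t' gives a summand update(d', check(d, l.t')) below t, and t is
   provably a sum of such summands; this needs check(d, 0) = 0 = update(d, 0) for d in D, derived from
   check(d, check(e, 0)) = 0 for some e in D other than d.  For bisimilar p and q, induction on size
   identifies each summand of p with one of q, so p \<le> q and by symmetry p = q. *)
theory Submission
  imports Defs
begin

section \<open>Closed terms, canonical summands and transitions\<close>

lemma sum_terms_simps [simp]:
  "sum_terms [] = Zero" "sum_terms (t # ts) = Plus t (sum_terms ts)"
  by (simp_all add: sum_terms_def)

lemma closed_terms_simps [simp]:
  "Zero \<in> closed_terms D L"
  "Prefix l t \<in> closed_terms D L \<longleftrightarrow> l \<in> L \<and> t \<in> closed_terms D L"
  "Check d t \<in> closed_terms D L \<longleftrightarrow> d \<in> D \<and> t \<in> closed_terms D L"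
  "Update d t \<in> closed_terms D L \<longleftrightarrow> d \<in> D \<and> t \<in> closed_terms D L"
  "Plus t u \<in> closed_terms D L \<longleftrightarrow> t \<in> closed_terms D L \<and> u \<in> closed_terms D L"
  by (auto intro: closed_terms.intros elim: closed_terms.cases)

lemma sum_terms_closed [simp]:
  "sum_terms ts \<in> closed_terms D L \<longleftrightarrow> set ts \<subseteq> closed_terms D L"
  by (induction ts) auto

lemma axiom_instance_closed:
  "axiom_instance D L x y \<Longrightarrow> x \<in> closed_terms D L \<and> y \<in> closed_terms D L"
  by (induction rule: axiom_instance.induct) auto

lemma derivable_closed:
  "derivable D L x y \<Longrightarrow> x \<in> closed_terms D L \<and> y \<in> closed_terms D L"
  by (induction rule: derivable.induct) (auto dest: axiom_instance_closed)

text \<open>For \<open>d\<close> and \<open>d'\<close> in \<open>D\<close>, the only transition of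
  this term is \<open>(d, l, d')\<close> to \<open>t\<close>. Keeping the update outermost makes the
  case \<open>d' = d\<close> literally the entry of the expansion axiom for a prefix.\<close>

definition summand :: "'d \<Rightarrow> 'l \<Rightarrow> 'd \<Rightarrow> ('d, 'l) trm \<Rightarrow> ('d, 'l) trm" where
  "summand d l d' t = Update d' (Check d (Prefix l t))"

lemma step_closed:
  assumes "step D t (d, l, d') t'" "t \<in> closed_terms D L"
  shows "d \<in> D" "l \<in> L" "d' \<in> D" "t' \<in> closed_terms D L"
proof -
  have "d \<in> D \<and> l \<in> L \<and> d' \<in> D \<and> t' \<in> closed_terms D L"
    using assms by (induction t "(d, l, d')" t' arbitrary: d d' rule: step.induct) auto
  then show "d \<in> D" "l \<in> L" "d' \<in> D" "t' \<in> closed_terms D L" by auto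
qed

text \<open>The target is always a proper subterm of the source. This is the measure that drives the
  completeness induction.\<close>

lemma step_size: "step D t a t' \<Longrightarrow> size t' < size t"
  by (induction rule: step.induct) auto

section \<open>The join semilattice order of provable inequality\<close>

context
  fixes D :: "'d set" and L :: "'l set"
begin

abbreviation provably_equal :: "('d, 'l) trm \<Rightarrow> ('d, 'l) trm \<Rightarrow> bool" (infix "\<approx>" 50) where
  "x \<approx> y \<equiv> derivable D L x y"

abbreviation closed :: "('d, 'l) trm set" where
  "closed \<equiv> closed_terms D L"

definition provably_le :: "('d, 'l) trm \<Rightarrow> ('d, 'l) trm \<Rightarrow> bool" (infix "\<preceq>" 50) where
  "u \<preceq> v \<longleftrightarrow> Plus v u \<approx> v"

lemma eq_trans [trans]: "x \<approx> y \<Longrightarrow> y \<approx> z \<Longrightarrow> x \<approx> z"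
  by (rule derivable.trans)

lemma le_closed: "u \<preceq> v \<Longrightarrow> u \<in> closed \<and> v \<in> closed"
  unfolding provably_le_def by (auto dest: derivable_closed)

text \<open>Idempotence of \<open>Plus\<close>. Together with transitivity this lets equations and
  inequalities be chained freely.\<close>

lemma eq_imp_le:
  assumes "u \<approx> v"
  shows "u \<preceq> v"
proof -
  have v: "v \<in> closed" using assms derivable_closed by blast
  have "Plus v u \<approx> Plus v v"
    using assms v by (intro derivable.cong_plus derivable.refl)
  also have "Plus v v \<approx> v"
    using v by (intro derivable.ax axiom_instance.plus_idem)
  finally show ?thesis unfolding provably_le_def .
qed

lemma plus_le:
  assumes "u \<preceq> w" "v \<preceq> w"
  shows "Plus u v \<preceq> w"
proof -
  have c: "u \<in> closed" "v \<in> closed" "w \<in> closed" using assms le_closed by blast+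
  have "Plus w (Plus u v) \<approx> Plus (Plus w u) v"
    using c by (intro derivable.ax axiom_instance.plus_assoc)
  also have "Plus (Plus w u) v \<approx> Plus w v"
    using assms(1) c unfolding provably_le_def by (intro derivable.cong_plus derivable.refl)
  also have "Plus w v \<approx> w" using assms(2) unfolding provably_le_def .
  finally show ?thesis unfolding provably_le_def .
qed

lemma le_trans [trans]:
  assumes "u \<preceq> v" "v \<preceq> w"
  shows "u \<preceq> w"
proof -
  have c: "u \<in> closed" "v \<in> closed" "w \<in> closed" using assms le_closed by blast+
  have wv: "Plus w v \<approx> w" and vu: "Plus v u \<approx> v" using assms unfolding provably_le_def by auto
  have "Plus w u \<approx> Plus (Plus w v) u"
    using wv c by (intro derivable.cong_plus derivable.refl derivable.sym[OF wv])
  also have "Plus (Plus w v) u \<approx> Plus w (Plus v u)"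
    using c by (intro derivable.sym[OF derivable.ax] axiom_instance.plus_assoc)
  also have "Plus w (Plus v u) \<approx> Plus w v"
    using vu c by (intro derivable.cong_plus derivable.refl)
  also note wv
  finally show ?thesis unfolding provably_le_def .
qed

text \<open>Both terms are provably equal to their join, by commutativity.\<close>

lemma le_antisym:
  assumes "u \<preceq> v" "v \<preceq> u"
  shows "u \<approx> v"
proof -
  have "u \<approx> Plus u v" using assms(2) unfolding provably_le_def by (rule derivable.sym)
  also have "Plus u v \<approx> Plus v u"
    using assms le_closed by (intro derivable.ax axiom_instance.plus_comm) blast+
  also have "Plus v u \<approx> v" using assms(1) unfolding provably_le_def .
  finally show ?thesis .
qed

lemma le_plus_right:
  assumes "x \<in> closed" "y \<in> closed"
  shows "y \<preceq> Plus x y"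
proof -
  have "Plus (Plus x y) y \<approx> Plus x (Plus y y)"
    using assms by (intro derivable.sym[OF derivable.ax] axiom_instance.plus_assoc)
  also have "Plus x (Plus y y) \<approx> Plus x y"
    using assms
    by (intro derivable.cong_plus derivable.refl derivable.ax axiom_instance.plus_idem)
  finally show ?thesis unfolding provably_le_def .
qed

lemma le_plus_left:
  assumes "x \<in> closed" "y \<in> closed"
  shows "x \<preceq> Plus x y"
proof -
  have "x \<preceq> Plus y x" using assms by (rule le_plus_right[rotated])
  also have "Plus y x \<preceq> Plus x y"
    using assms by (intro eq_imp_le derivable.ax axiom_instance.plus_comm)
  finally show ?thesis .
qed

lemma zero_le: "x \<in> closed \<Longrightarrow> Zero \<preceq> x"
  unfolding provably_le_def by (intro derivable.ax axiom_instance.plus_zero)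

text \<open>Distributivity of \<open>Check d\<close> over \<open>Plus\<close> carries the equation
  that witnesses \<open>u \<preceq> v\<close> to the images.\<close>

lemma check_mono:
  assumes "u \<preceq> v" "d \<in> D"
  shows "Check d u \<preceq> Check d v"
proof -
  have "Plus (Check d v) (Check d u) \<approx> Check d (Plus v u)"
    using assms le_closed
    by (intro derivable.sym[OF derivable.ax] axiom_instance.check_plus) blast+
  also have "Check d (Plus v u) \<approx> Check d v"
    using assms unfolding provably_le_def by (intro derivable.cong_check)
  finally show ?thesis unfolding provably_le_def .
qed

lemma update_mono:
  assumes "u \<preceq> v" "d \<in> D"
  shows "Update d u \<preceq> Update d v"
proof -
  have "Plus (Update d v) (Update d u) \<approx> Update d (Plus v u)"
    using assms le_closed
    by (intro derivable.sym[OF derivable.ax] axiom_instance.update_plus) blast+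
  also have "Update d (Plus v u) \<approx> Update d v"
    using assms unfolding provably_le_def by (intro derivable.cong_update)
  finally show ?thesis unfolding provably_le_def .
qed

lemma le_sum_terms:
  assumes "t \<in> set ts" "set ts \<subseteq> closed"
  shows "t \<preceq> sum_terms ts"
  using assms
proof (induction ts)
  case (Cons s ts)
  show ?case
  proof (cases "t = s")
    case True
    then show ?thesis using Cons.prems by (simp add: le_plus_left)
  next
    case False
    then have "t \<preceq> sum_terms ts" using Cons by auto
    also have "sum_terms ts \<preceq> sum_terms (s # ts)"
      using Cons.prems by (simp add: le_plus_right)
    finally show ?thesis .
  qed
qed simp

section \<open>Equations for single summands and their position below terms\<close>

lemma summand_cong:
  assumes "x \<approx> y" "d \<in> D" "l \<in> L" "d' \<in> D"
  shows "summand d l d' x \<approx> summand d l d' y"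
  using assms unfolding summand_def
  by (intro derivable.cong_update derivable.cong_check derivable.cong_prefix)

text \<open>The outer check commutes with the update and is absorbed by the equal check
  inside.\<close>

lemma check_summand:
  assumes "x \<in> closed" "d \<in> D" "l \<in> L" "d' \<in> D"
  shows "Check d (summand d l d' x) \<approx> summand d l d' x"
proof -
  have "Check d (Update d' (Check d (Prefix l x))) \<approx> Update d' (Check d (Check d (Prefix l x)))"
    using assms by (intro derivable.ax axiom_instance.check_update) auto
  also have "\<dots> \<approx> Update d' (Check d (Prefix l x))"
    using assms by (intro derivable.cong_update derivable.ax axiom_instance.check_same) auto
  finally show ?thesis unfolding summand_def .
qed

lemma update_summand:
  assumes "x \<in> closed" "d \<in> D" "l \<in> L" "d' \<in> D" "e \<in> D"
  shows "Update e (summand d l d' x) \<approx> summand d l e x"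
  using assms unfolding summand_def by (intro derivable.ax axiom_instance.update_update) auto

lemma prefix_eq_sum:
  assumes "l \<in> L" "x \<in> closed" "distinct ds" "set ds = D"
  shows "Prefix l x \<approx> sum_terms (map (\<lambda>d. summand d l d x) ds)"
  using assms unfolding summand_def by (intro derivable.ax axiom_instance.prefix_expand)

text \<open>Induction on the derivation of the transition. A prefix lies above its summands by the
  expansion axiom, where finiteness of \<open>D\<close> supplies the enumeration; monotonicity lifts
  the claim through checks and updates, and a choice lies above both of its arguments.\<close>

lemma summand_le:
  assumes "finite D" "step D t (d, l, d') t'" "t \<in> closed"
  shows "summand d l d' t' \<preceq> t"
  using assms(2,3)
proof (induction t "(d, l, d')" t' arbitrary: d d' rule: step.induct)
  case (prefix d x)
  obtain ds where ds: "distinct ds" "set ds = D"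
    using finite_distinct_list[OF assms(1)] by blast
  have "summand d l d x \<preceq> sum_terms (map (\<lambda>d. summand d l d x) ds)"
    using prefix ds by (intro le_sum_terms) (auto simp: summand_def)
  also have "\<dots> \<preceq> Prefix l x"
    using prefix ds by (intro eq_imp_le derivable.sym[OF prefix_eq_sum]) auto
  finally show ?case .
next
  case (check x d d' x')
  then have c: "x \<in> closed" by simp
  note m = step_closed[OF check.hyps(1) c]
  \<comment> \<open>The check rule fires only when the checked value is the source value
    \<open>d\<close> of the transition, so the check is absorbed.\<close>
  have "summand d l d' x' \<preceq> Check d (summand d l d' x')"
    using m by (intro eq_imp_le derivable.sym[OF check_summand])
  also have "\<dots> \<preceq> Check d x" using check m c by (intro check_mono) auto
  finally show ?case .
next
  case (update x d d' x' e)
  then have c: "x \<in> closed" by simp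
  note m = step_closed[OF update.hyps(1) c]
  have "summand d l e x' \<preceq> Update e (summand d l d' x')"
    using m update.hyps by (intro eq_imp_le derivable.sym[OF update_summand]) auto
  also have "\<dots> \<preceq> Update e x" using update c by (intro update_mono) auto
  finally show ?case .
next
  case (plus_left x d d' x' y)
  then show ?case using le_trans[OF _ le_plus_left[of x y]] by simp
next
  case (plus_right x d d' x' y)
  then show ?case using le_trans[OF _ le_plus_right[of y x]] by simp
qed

section \<open>Terms provably equal to finite sums over a set\<close>

text \<open>Closure under provable equality removes all bookkeeping about order, bracketing and
  repetition of the summands; \<open>Zero\<close> is the empty sum.\<close>

inductive_set sums :: "('d, 'l) trm set \<Rightarrow> ('d, 'l) trm set" for S where
  zero: "Zero \<in> sums S"
| elem: "s \<in> S \<Longrightarrow> s \<in> sums S"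
| plus: "u \<in> sums S \<Longrightarrow> v \<in> sums S \<Longrightarrow> Plus u v \<in> sums S"
| eq: "u \<in> sums S \<Longrightarrow> v \<approx> u \<Longrightarrow> v \<in> sums S"

lemma sums_mono: "u \<in> sums S \<Longrightarrow> S \<subseteq> T \<Longrightarrow> u \<in> sums T"
  by (induction rule: sums.induct) (auto intro: sums.intros)

lemma sum_terms_sums: "set ts \<subseteq> S \<Longrightarrow> sum_terms ts \<in> sums S"
  by (induction ts) (auto intro: sums.intros)

lemma sums_closed: "u \<in> sums S \<Longrightarrow> S \<subseteq> closed \<Longrightarrow> u \<in> closed"
  by (induction rule: sums.induct) (auto dest: derivable_closed)

text \<open>\<open>Zero\<close> is the least element and \<open>Plus\<close> the join, so an upper
  bound of \<open>S\<close> also bounds every sum over \<open>S\<close>.\<close>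

lemma sums_le:
  assumes "u \<in> sums S" "\<And>s. s \<in> S \<Longrightarrow> s \<preceq> q" "q \<in> closed"
  shows "u \<preceq> q"
  using assms by (induction rule: sums.induct) (auto intro: zero_le plus_le le_trans eq_imp_le)

section \<open>Checks and updates of zero and of sums\<close>

lemma check_zero:
  assumes "card D \<noteq> 1" "d \<in> D"
  shows "Check d Zero \<approx> Zero"
proof -
  \<comment> \<open>As \<open>d\<close> lies in \<open>D\<close>, a cardinality other than 1 forces
    a second element; this includes infinite \<open>D\<close>, where \<open>card D\<close> is
    0.\<close>
  obtain e where e: "e \<in> D" "d \<noteq> e"
    using assms by (metis is_singletonI' is_singleton_altdef empty_iff)
  have z: "Zero \<approx> Check d (Check e Zero)"
    using assms e by (intro derivable.sym[OF derivable.ax] axiom_instance.check_diff) auto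
  have "Check d Zero \<approx> Check d (Check d (Check e Zero))"
    using z assms by (intro derivable.cong_check)
  also have "\<dots> \<approx> Check d (Check e Zero)"
    using assms e by (intro derivable.ax axiom_instance.check_same) auto
  also have "\<dots> \<approx> Zero" using z by (rule derivable.sym)
  finally show ?thesis .
qed

text \<open>With \<open>e\<close> different from \<open>d\<close>, \<open>Zero\<close> is rewritten
  as two conflicting checks of \<open>Zero\<close>. The update then moves inside both checks, and
  the conflict annihilates it.\<close>

lemma update_zero:
  assumes "card D \<noteq> 1" "d \<in> D"
  shows "Update d Zero \<approx> Zero"
proof -
  obtain e where e: "e \<in> D" "d \<noteq> e"
    using assms by (metis is_singletonI' is_singleton_altdef empty_iff)
  have "Update d Zero \<approx> Update d (Check d (Check e Zero))"
    using assms e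
    by (intro derivable.cong_update derivable.sym[OF derivable.ax] axiom_instance.check_diff) auto
  also have "\<dots> \<approx> Check d (Update d (Check e Zero))"
    using assms e by (intro derivable.sym[OF derivable.ax] axiom_instance.check_update) auto
  also have "\<dots> \<approx> Check d (Check e (Update d Zero))"
    using assms e
    by (intro derivable.cong_check derivable.sym[OF derivable.ax] axiom_instance.check_update) auto
  also have "\<dots> \<approx> Zero"
    using assms e by (intro derivable.ax axiom_instance.check_diff) auto
  finally show ?thesis .
qed

text \<open>Behind the update the outer check meets a conflicting one; what is left is an update of
  \<open>Zero\<close>.\<close>

lemma check_summand_diff:
  assumes "card D \<noteq> 1" "x \<in> closed" "d \<in> D" "l \<in> L" "d' \<in> D" "c \<in> D" "c \<noteq> d"
  shows "Check c (summand d l d' x) \<approx> Zero"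
proof -
  have "Check c (Update d' (Check d (Prefix l x))) \<approx> Update d' (Check c (Check d (Prefix l x)))"
    using assms by (intro derivable.ax axiom_instance.check_update) auto
  also have "\<dots> \<approx> Update d' Zero"
    using assms by (intro derivable.cong_update derivable.ax axiom_instance.check_diff) auto
  also have "\<dots> \<approx> Zero" using assms by (intro update_zero)
  finally show ?thesis unfolding summand_def .
qed

text \<open>By distributivity it is enough to treat single elements of \<open>S\<close>; the empty
  sum is settled by \<open>check_zero\<close>.\<close>

lemma check_sums:
  assumes "u \<in> sums S" "S \<subseteq> closed" "c \<in> D" "card D \<noteq> 1"
    and "\<And>s. s \<in> S \<Longrightarrow> Check c s \<in> sums T"
  shows "Check c u \<in> sums T"
  using assms(1)
proof (induction rule: sums.induct)
  case zero
  show ?case using check_zero[OF assms(4,3)] by (rule sums.eq[OF sums.zero])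
next
  case (elem s)
  then show ?case by (rule assms(5))
next
  case (plus u v)
  have "u \<in> closed" "v \<in> closed" using plus.hyps sums_closed assms(2) by blast+
  with assms(3) have "Check c (Plus u v) \<approx> Plus (Check c u) (Check c v)"
    by (intro derivable.ax axiom_instance.check_plus)
  then show ?case using plus.IH by (blast intro: sums.plus sums.eq)
next
  case (eq u v)
  then show ?case using assms(3) by (blast intro: sums.eq derivable.cong_check)
qed

lemma update_sums:
  assumes "u \<in> sums S" "S \<subseteq> closed" "c \<in> D" "card D \<noteq> 1"
    and "\<And>s. s \<in> S \<Longrightarrow> Update c s \<in> sums T"
  shows "Update c u \<in> sums T"
  using assms(1)
proof (induction rule: sums.induct)
  case zero
  show ?case using update_zero[OF assms(4,3)] by (rule sums.eq[OF sums.zero])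
next
  case (elem s)
  then show ?case by (rule assms(5))
next
  case (plus u v)
  have "u \<in> closed" "v \<in> closed" using plus.hyps sums_closed assms(2) by blast+
  with assms(3) have "Update c (Plus u v) \<approx> Plus (Update c u) (Update c v)"
    by (intro derivable.ax axiom_instance.update_plus)
  then show ?case using plus.IH by (blast intro: sums.plus sums.eq)
next
  case (eq u v)
  then show ?case using assms(3) by (blast intro: sums.eq derivable.cong_update)
qed

section \<open>Head normal forms\<close>

definition summands :: "('d, 'l) trm \<Rightarrow> ('d, 'l) trm set" where
  "summands t = {summand d l d' t' | d l d' t'. step D t (d, l, d') t'}"

lemma summandsI: "step D t (d, l, d') t' \<Longrightarrow> summand d l d' t' \<in> summands t"
  by (auto simp: summands_def)

lemma summands_closed: "t \<in> closed \<Longrightarrow> summands t \<subseteq> closed"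
  by (auto simp: summands_def summand_def dest: step_closed)

text \<open>Structural induction. A prefix is expanded by its axiom; a check keeps the matching
  summands and turns the others into \<open>Zero\<close>; an update overwrites the target value of
  each summand; a choice unites the summands of its arguments.\<close>

lemma in_sums_summands:
  assumes "finite D" "card D \<noteq> 1" "t \<in> closed"
  shows "t \<in> sums (summands t)"
  using assms(3)
proof (induction t rule: closed_terms.induct)
  case zero
  show ?case by (rule sums.zero)
next
  case (prefix l t)
  obtain ds where ds: "distinct ds" "set ds = D"
    using finite_distinct_list[OF assms(1)] by blast
  have "sum_terms (map (\<lambda>d. summand d l d t) ds) \<in> sums (summands (Prefix l t))"
    by (intro sum_terms_sums) (auto simp: ds intro: summandsI step.prefix)
  then show ?case using prefix_eq_sum[OF prefix.hyps ds] by (rule sums.eq)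
next
  case (check c t)
  show ?case
  proof (rule check_sums[OF check.IH summands_closed[OF check.hyps(2)] check.hyps(1) assms(2)])
    fix s assume "s \<in> summands t"
    then obtain d l d' t' where s: "s = summand d l d' t'" and st: "step D t (d, l, d') t'"
      by (auto simp: summands_def)
    note m = step_closed[OF st check.hyps(2)]
    show "Check c s \<in> sums (summands (Check c t))"
    proof (cases "c = d")
      case True
      have "s \<in> summands (Check c t)"
        using summandsI[OF step.check[OF st]] s True by simp
      moreover have "Check c s \<approx> s" using m s True check_summand by blast
      ultimately show ?thesis by (blast intro: sums.intros)
    next
      case False
      then have "Check c s \<approx> Zero"
        using m s check.hyps(1) assms(2) check_summand_diff by blast
      then show ?thesis by (blast intro: sums.intros)
    qed
  qed
next
  case (update c t)
  show ?case
  proof (rule update_sums[OF update.IH summands_closed[OF update.hyps(2)] update.hyps(1) assms(2)])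
    fix s assume "s \<in> summands t"
    then obtain d l d' t' where s: "s = summand d l d' t'" and st: "step D t (d, l, d') t'"
      by (auto simp: summands_def)
    \<comment> \<open>The new summand has the same source value and continuation, with target value
      \<open>c\<close>, and the update rule yields the corresponding transition.\<close>
    have "summand d l c t' \<in> summands (Update c t)"
      by (rule summandsI[OF step.update[OF st update.hyps(1)]])
    moreover have "Update c s \<approx> summand d l c t'"
      using step_closed[OF st update.hyps(2)] s update.hyps(1) update_summand by blast
    ultimately show "Update c s \<in> sums (summands (Update c t))" by (blast intro: sums.intros)
  qed
next
  case (plus t u)
  have "summands t \<subseteq> summands (Plus t u)" "summands u \<subseteq> summands (Plus t u)"
    unfolding summands_def by (blast intro: step.plus_left step.plus_right)+
  then show ?case using plus.IH by (blast intro: sums.plus sums_mono)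
qed

section \<open>Completeness by induction on size\<close>

lemma bisimulation_derivable:
  assumes "finite D" "card D \<noteq> 1" and R: "bisimulation D L R" and "(p, q) \<in> R"
  shows "p \<approx> q"
  using assms(4)
proof (induction "size p + size q" arbitrary: p q rule: less_induct)
  case less
  have closed: "p \<in> closed" "q \<in> closed" if "(p, q) \<in> R" for p q
    using R that by (auto simp: bisimulation_def)
  have qp: "(q, p) \<in> R" using R less.prems by (auto simp: bisimulation_def dest: symD)
  \<comment> \<open>The claim is stated for every pair of \<open>R\<close> with the same total size,
    so that it covers both \<open>(p, q)\<close> and \<open>(q, p)\<close>.\<close>
  have le: "u \<preceq> v" if uv: "(u, v) \<in> R" and size: "size u + size v = size p + size q" for u v
  proof (rule sums_le[OF in_sums_summands[OF assms(1,2) closed(1)[OF uv]]])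
    fix s assume "s \<in> summands u"
    then obtain d l d' u' where s: "s = summand d l d' u'" and st: "step D u (d, l, d') u'"
      by (auto simp: summands_def)
    obtain v' where st': "step D v (d, l, d') v'" and R': "(u', v') \<in> R"
      using R uv st unfolding bisimulation_def by blast
    \<comment> \<open>Both targets are strictly smaller than their sources, so the induction
      hypothesis applies to the matched pair.\<close>
    have "u' \<approx> v'"
      using less.hyps[OF _ R'] step_size[OF st] step_size[OF st'] size by simp
    then have "s \<preceq> summand d l d' v'"
      using step_closed[OF st closed(1)[OF uv]] unfolding s by (intro eq_imp_le summand_cong)
    also have "\<dots> \<preceq> v" using summand_le[OF assms(1) st' closed(2)[OF uv]] .
    finally show "s \<preceq> v" .
  qed (rule closed(2)[OF uv])
  show ?case using le[OF less.prems] le[OF qp] by (intro le_antisym) auto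
qed

end

theorem mainTheorem4:
  fixes D :: "'d set" and L :: "'l set" and p q :: "('d, 'l) trm"
  assumes "finite D"
    and "card D \<noteq> 1"
    and "p \<in> closed_terms D L" and "q \<in> closed_terms D L"
    and "strongly_bisimilar D L p q"
  shows "derivable D L p q"
  using assms bisimulation_derivable unfolding strongly_bisimilar_def by blast

end
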